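(* Let $T$ be a Leibniz triple system with universal Leibniz envelope $U(T)$, and let $\theta$ be the involutive automorphism of $U(T)$ determining $T$. If $f$ is an automorphism of $U(T)$ satisfying $f\theta=\theta f$, then $f(T)\subseteq T$ and $f|_T$ is an automorphism of $T$.
   Context: All vector spaces are finite-dimensional over a fixed field $\mathbb{K}$ of characteristic $0$. A Leibniz triple system is a vector space $T$ with a trilinear operation $\{\cdot,\cdot,\cdot\}:T\times T\times T\to T$ satisfying, for all $a,b,c,d,e\in T$, $\{a\{bcd\}e\}=\{\{abc\}de\}-\{\{acb\}de\}-\{\{adb\}ce\}+\{\{adc\}be\}$ and $\{ab\{cde\}\}=\{\{abc\}de\}-\{\{abd\}ce\}-\{\{abe\}cd\}+\{\{abe\}dc\}$. An automorphism of $T$ is a bijective linear map preserving the triple product. The universal Leibniz envelope of $T$ is the Leibniz algebra (bilinear bracket with $[[x,y],z]=[[x,z],y]+[x,[y,z]]$) $U(T)=T\oplus(T\otimes T)$ with bracket $[a,b]=a\otimes b$, $[a\otimes b,c]=\{abc\}$, $[a,b\otimes c]=\{abc\}-\{acb\}$, $[a\otimes b,c\otimes d]=\{abc\}\otimes d-\{abd\}\otimes c$. $T$ is identified with the first summand. The involutive automorphism of $U(T)$ determining $T$ is the map $\theta(a+\sum b\otimes c)=-a+\sum b\otimes c$; it is the unique automorphism of $U(T)$ with $\theta^2=\mathrm{id}$ and $T=\{x\in U(T)\mid\theta(x)=-x\}$. *)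

theory Defs
  imports Complex_Main "HOL-Library.Function_Algebras" "HOL-Library.Product_Plus"
begin

section \<open>Linear maps on subspaces and bilinear maps\<close>

text \<open>The library's \<open>linear\<close> is about whole types; here the domain is a subset \<open>S\<close> of a type
  (in all uses below, a subspace).\<close>

definition linear_on ::
  "('k \<Rightarrow> 'a \<Rightarrow> 'a) \<Rightarrow> ('k \<Rightarrow> 'b \<Rightarrow> 'b) \<Rightarrow> 'a set \<Rightarrow> ('a::ab_group_add \<Rightarrow> 'b::ab_group_add) \<Rightarrow> bool"
  where "linear_on s1 s2 S g \<longleftrightarrow>
    (\<forall>x\<in>S. \<forall>y\<in>S. g (x + y) = g x + g y) \<and> (\<forall>c. \<forall>x\<in>S. g (s1 c x) = s2 c (g x))"

definition bilinear_map ::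
  "('k::field \<Rightarrow> 'v \<Rightarrow> 'v) \<Rightarrow> ('k \<Rightarrow> 'x \<Rightarrow> 'x) \<Rightarrow> ('v::ab_group_add \<Rightarrow> 'v \<Rightarrow> 'x::ab_group_add) \<Rightarrow> bool"
  where "bilinear_map s s' h \<longleftrightarrow>
    (\<forall>b. Vector_Spaces.linear s s' (\<lambda>a. h a b)) \<and> (\<forall>a. Vector_Spaces.linear s s' (\<lambda>b. h a b))"

section \<open>Leibniz triple systems\<close>

locale leibniz_triple_system = finite_dimensional_vector_space scale Basis
  for scale :: "'k::field_char_0 \<Rightarrow> 'v::ab_group_add \<Rightarrow> 'v" and Basis :: "'v set" +
  fixes triple :: "'v \<Rightarrow> 'v \<Rightarrow> 'v \<Rightarrow> 'v"
  assumes linear_1: "Vector_Spaces.linear scale scale (\<lambda>a. triple a b c)"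
    and linear_2: "Vector_Spaces.linear scale scale (\<lambda>b. triple a b c)"
    and linear_3: "Vector_Spaces.linear scale scale (\<lambda>c. triple a b c)"
    and LTS_1: "triple a (triple b c d) e =
      triple (triple a b c) d e - triple (triple a c b) d e
      - triple (triple a d b) c e + triple (triple a d c) b e"
    and LTS_2: "triple a b (triple c d e) =
      triple (triple a b c) d e - triple (triple a b d) c e
      - triple (triple a b e) c d + triple (triple a b e) d c"

definition triple_automorphism ::
  "('k::field_char_0 \<Rightarrow> 'v::ab_group_add \<Rightarrow> 'v) \<Rightarrow> ('v \<Rightarrow> 'v \<Rightarrow> 'v \<Rightarrow> 'v) \<Rightarrow> ('v \<Rightarrow> 'v) \<Rightarrow> bool"
  where "triple_automorphism scale triple g \<longleftrightarrow>
    Vector_Spaces.linear scale scale g \<and> bij g \<and>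
    (\<forall>a b c. g (triple a b c) = triple (g a) (g b) (g c))"

section \<open>The tensor square of a vector space\<close>

text \<open>A tensor is represented by its action on bilinear forms, the pure tensor of \<open>a\<close> and \<open>b\<close>
  acting by \<open>\<beta> \<mapsto> \<beta> a b\<close>. The tensor square is the span of the pure tensors; the theorem
  \<open>tensor_universal\<close> below shows that it has the universal property of the tensor product.
  The value on functions that are not bilinear forms is irrelevant and is set to \<open>0\<close>.\<close>

type_synonym ('k, 'v) tensor = "('v \<Rightarrow> 'v \<Rightarrow> 'k) \<Rightarrow> 'k"

definition tensor_scale :: "'k::field \<Rightarrow> ('k, 'v) tensor \<Rightarrow> ('k, 'v) tensor"
  where "tensor_scale c t = (\<lambda>\<beta>. c * t \<beta>)"

definition pure_tensor ::
  "('k::field \<Rightarrow> 'v::ab_group_add \<Rightarrow> 'v) \<Rightarrow> 'v \<Rightarrow> 'v \<Rightarrow> ('k, 'v) tensor"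
  where "pure_tensor scale a b = (\<lambda>\<beta>. if bilinear_map scale (*) \<beta> then \<beta> a b else 0)"

global_interpretation tensor: vector_space "tensor_scale :: 'k::field \<Rightarrow> ('k, 'v) tensor \<Rightarrow> ('k, 'v) tensor"
  by unfold_locales (auto simp: tensor_scale_def fun_eq_iff algebra_simps)

definition tensor_square ::
  "('k::field \<Rightarrow> 'v::ab_group_add \<Rightarrow> 'v) \<Rightarrow> ('k, 'v) tensor set"
  where "tensor_square scale = tensor.span {pure_tensor scale a b | a b. True}"

definition tensor_lift ::
  "('k::field \<Rightarrow> 'v::ab_group_add \<Rightarrow> 'v) \<Rightarrow> ('k \<Rightarrow> 'x::ab_group_add \<Rightarrow> 'x) \<Rightarrow> ('v \<Rightarrow> 'v \<Rightarrow> 'x)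
    \<Rightarrow> ('k, 'v) tensor \<Rightarrow> 'x"
  where "tensor_lift scale s' h =
    (THE g. linear_on tensor_scale s' (tensor_square scale) g \<and>
      (\<forall>a b. g (pure_tensor scale a b) = h a b) \<and> (\<forall>t. t \<notin> tensor_square scale \<longrightarrow> g t = 0))"

section \<open>The universal Leibniz envelope\<close>

type_synonym ('k, 'v) envelope = "'v \<times> ('k, 'v) tensor"

definition env_carrier ::
  "('k::field \<Rightarrow> 'v::ab_group_add \<Rightarrow> 'v) \<Rightarrow> ('k, 'v) envelope set"
  where "env_carrier scale = UNIV \<times> tensor_square scale"

definition env_scale ::
  "('k::field \<Rightarrow> 'v::ab_group_add \<Rightarrow> 'v) \<Rightarrow> 'k \<Rightarrow> ('k, 'v) envelope \<Rightarrow> ('k, 'v) envelope"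
  where "env_scale scale c x = (scale c (fst x), tensor_scale c (snd x))"

text \<open>For \<open>x = a + u\<close> and \<open>y = b + w\<close> with \<open>u\<close>, \<open>w\<close> in the tensor square, the three lifts are the
  brackets \<open>[u, b]\<close>, \<open>[a, w]\<close> and \<open>[u, w]\<close>, see \<open>env_bracket_pure\<close> below.
  The bracket on the whole of \<open>T \<oplus> (T \<otimes> T)\<close> is only asserted to be bilinear: the Leibniz identity
  is not used, and it can fail on the full tensor square (e.g. for \<open>T\<close> with basis \<open>e\<close>, \<open>e'\<close> whose only
  nonzero product of basis vectors is \<open>{e e e} = e'\<close>).\<close>

definition env_bracket ::
  "('k::field \<Rightarrow> 'v::ab_group_add \<Rightarrow> 'v) \<Rightarrow> ('v \<Rightarrow> 'v \<Rightarrow> 'v \<Rightarrow> 'v)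
    \<Rightarrow> ('k, 'v) envelope \<Rightarrow> ('k, 'v) envelope \<Rightarrow> ('k, 'v) envelope"
  where "env_bracket scale triple = (\<lambda>(a, u) (b, w).
    (tensor_lift scale scale (\<lambda>p q. triple p q b) u
      + tensor_lift scale scale (\<lambda>p q. triple a p q - triple a q p) w,
     pure_tensor scale a b
      + tensor_lift scale tensor_scale
          (\<lambda>p q. tensor_lift scale tensor_scale
            (\<lambda>r s. pure_tensor scale (triple p q r) s - pure_tensor scale (triple p q s) r) w) u))"

definition env_incl :: "'v \<Rightarrow> ('k::field, 'v::ab_group_add) envelope"
  where "env_incl a = (a, 0)"

definition env_theta :: "('k::field, 'v::ab_group_add) envelope \<Rightarrow> ('k, 'v) envelope"
  where "env_theta = (\<lambda>(a, u). (- a, u))"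

text \<open>Maps on the envelope are functions on the ambient type, of which only the values on the
  carrier matter.\<close>

definition env_automorphism ::
  "('k::field \<Rightarrow> 'v::ab_group_add \<Rightarrow> 'v) \<Rightarrow> ('v \<Rightarrow> 'v \<Rightarrow> 'v \<Rightarrow> 'v)
    \<Rightarrow> (('k, 'v) envelope \<Rightarrow> ('k, 'v) envelope) \<Rightarrow> bool"
  where "env_automorphism scale triple f \<longleftrightarrow>
    bij_betw f (env_carrier scale) (env_carrier scale) \<and>
    linear_on (env_scale scale) (env_scale scale) (env_carrier scale) f \<and>
    (\<forall>x\<in>env_carrier scale. \<forall>y\<in>env_carrier scale.
      f (env_bracket scale triple x y) = env_bracket scale triple (f x) (f y))"

section \<open>The tensor square has the universal property\<close>

lemma pure_tensor_in [simp]: "pure_tensor scale a b \<in> tensor_square scale"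
  unfolding tensor_square_def by (rule tensor.span_base) blast

lemma tensor_square_closed:
  shows "0 \<in> tensor_square scale"
    and "t \<in> tensor_square scale \<Longrightarrow> u \<in> tensor_square scale \<Longrightarrow> t + u \<in> tensor_square scale"
    and "t \<in> tensor_square scale \<Longrightarrow> u \<in> tensor_square scale \<Longrightarrow> t - u \<in> tensor_square scale"
    and "t \<in> tensor_square scale \<Longrightarrow> tensor_scale c t \<in> tensor_square scale"
  unfolding tensor_square_def
  by (blast intro: tensor.span_zero tensor.span_add tensor.span_diff tensor.span_scale)+

lemma tensor_square_induct [consumes 1, case_names zero step]:
  assumes "t \<in> tensor_square scale"
    and "P 0" and "\<And>c a b u. u \<in> tensor_square scale \<Longrightarrow> P u \<Longrightarrow> P (tensor_scale c (pure_tensor scale a b) + u)"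
  shows "P t"
proof -
  have "t \<in> tensor.span {pure_tensor scale a b | a b. True}"
    using assms(1) by (simp add: tensor_square_def)
  then have "t \<in> tensor_square scale \<and> P t"
  proof (induction rule: tensor.span_induct_alt)
    case base
    then show ?case using assms(2) tensor_square_closed(1) by blast
  next
    case (step c x y)
    then show ?case using assms(3) tensor_square_closed(2,4) pure_tensor_in by blast
  qed
  then show ?thesis ..
qed

lemma linear_on_zero:
  assumes "linear_on tensor_scale s' (tensor_square scale) g"
  shows "g 0 = 0"
proof -
  have "g (0 + 0) = g 0 + g 0"
    using assms tensor_square_closed(1) unfolding linear_on_def by blast
  then show ?thesis by (simp del: zero_fun_apply)
qed

lemma linear_on_span_eq:
  assumes g: "linear_on tensor_scale s' (tensor_square scale) g"
    and g': "linear_on tensor_scale s' (tensor_square scale) g'"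
    and eq: "\<And>a b. g (pure_tensor scale a b) = g' (pure_tensor scale a b)"
    and t: "t \<in> tensor_square scale"
  shows "g t = g' t"
  using t
proof (induction t rule: tensor_square_induct)
  case zero
  show ?case by (simp only: linear_on_zero[OF g] linear_on_zero[OF g'])
next
  case (step c a b u)
  have "h (tensor_scale c (pure_tensor scale a b) + u) = s' c (h (pure_tensor scale a b)) + h u"
    if "linear_on tensor_scale s' (tensor_square scale) h" for h
    using that step(1) tensor_square_closed(4)[OF pure_tensor_in, of c scale a b] pure_tensor_in[of scale a b]
    unfolding linear_on_def by metis
  then show ?case using g g' eq step(2) by metis
qed

lemma vector_space_times: "vector_space ((*) :: 'k::field \<Rightarrow> 'k \<Rightarrow> 'k)"
  by unfold_locales (simp_all add: algebra_simps)

lemma bilinear_mapI: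
  assumes "vector_space s" "vector_space s'"
    and "\<And>a a' b. h (a + a') b = h a b + h a' b" "\<And>c a b. h (s c a) b = s' c (h a b)"
    and "\<And>a b b'. h a (b + b') = h a b + h a b'" "\<And>c a b. h a (s c b) = s' c (h a b)"
  shows "bilinear_map s s' h"
  unfolding bilinear_map_def Vector_Spaces.linear_iff using assms by blast

lemma bilinear_mapD:
  assumes "bilinear_map s s' h"
  shows "h (a + a') b = h a b + h a' b" "h (s c a) b = s' c (h a b)"
    "h a (b + b') = h a b + h a b'" "h a (s c b) = s' c (h a b)"
  using assms unfolding bilinear_map_def Vector_Spaces.linear_iff by blast+

context finite_dimensional_vector_space
begin

abbreviation (input) coord :: "'b \<Rightarrow> 'b \<Rightarrow> 'a" where "coord e v \<equiv> representation Basis v e"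

lemma bilinear_coord: "bilinear_map scale (*) (\<lambda>a b. coord e a * coord e' b)"
  by (rule bilinear_mapI[OF vector_space_axioms vector_space_times])
    (simp_all add: representation_add representation_scale independent_Basis span_Basis algebra_simps)

lemma sum_coord: "(\<Sum>e\<in>Basis. scale (coord e v) e) = v"
  using sum_representation_eq[OF independent_Basis, of v Basis] finite_Basis by (simp add: span_Basis)

lemma tensor_universal_ex:
  assumes "vector_space s'" and h: "bilinear_map scale s' h"
  shows "\<exists>g. linear_on tensor_scale s' (tensor_square scale) g \<and>
    (\<forall>a b. g (pure_tensor scale a b) = h a b)"
proof -
  interpret X: vector_space s' by fact
  define g where "g t = (\<Sum>e\<in>Basis. \<Sum>e'\<in>Basis. s' (t (\<lambda>a b. coord e a * coord e' b)) (h e e'))"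
    for t :: "('a, 'b) tensor"
  have "linear_on tensor_scale s' (tensor_square scale) g"
    unfolding linear_on_def g_def tensor_scale_def
    by (simp add: X.scale_left_distrib sum.distrib X.scale_sum_right)
  moreover have "g (pure_tensor scale a b) = h a b" for a b
  proof -
    have h1: "Vector_Spaces.linear scale s' (\<lambda>a. h a b)" for b using h by (simp add: bilinear_map_def)
    have h2: "Vector_Spaces.linear scale s' (\<lambda>b. h a b)" for a using h by (simp add: bilinear_map_def)
    interpret vector_space_pair scale s' by unfold_locales
    have "h a b = h (\<Sum>e\<in>Basis. scale (coord e a) e) b"
      by (simp add: sum_coord)
    also have "\<dots> = (\<Sum>e\<in>Basis. s' (coord e a) (h e b))"
      by (simp add: linear_sum[OF h1] linear_scale[OF h1])
    also have "\<dots> = (\<Sum>e\<in>Basis. s' (coord e a) (h e (\<Sum>e'\<in>Basis. scale (coord e' b) e')))"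
      by (simp add: sum_coord)
    also have "\<dots> = (\<Sum>e\<in>Basis. \<Sum>e'\<in>Basis. s' (coord e a * coord e' b) (h e e'))"
      by (simp only: linear_sum[OF h2] linear_scale[OF h2] X.scale_sum_right X.scale_scale)
    finally show ?thesis by (simp add: g_def pure_tensor_def bilinear_coord)
  qed
  ultimately show ?thesis by blast
qed

theorem tensor_universal:
  assumes "vector_space s'" and h: "bilinear_map scale s' h"
  shows "\<exists>!g. linear_on tensor_scale s' (tensor_square scale) g \<and>
    (\<forall>a b. g (pure_tensor scale a b) = h a b) \<and> (\<forall>t. t \<notin> tensor_square scale \<longrightarrow> g t = 0)"
proof -
  obtain g where g: "linear_on tensor_scale s' (tensor_square scale) g"
    "\<And>a b. g (pure_tensor scale a b) = h a b"
    using tensor_universal_ex[OF assms] by blast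
  define g' where "g' t = (if t \<in> tensor_square scale then g t else 0)" for t
  have "linear_on tensor_scale s' (tensor_square scale) g'"
    using g(1) unfolding linear_on_def g'_def
    by (auto simp: tensor_square_def tensor.span_add tensor.span_scale)
  then have *: "linear_on tensor_scale s' (tensor_square scale) g' \<and>
    (\<forall>a b. g' (pure_tensor scale a b) = h a b) \<and> (\<forall>t. t \<notin> tensor_square scale \<longrightarrow> g' t = 0)"
    using g(2) by (auto simp: g'_def)
  show ?thesis
  proof (rule ex1I[of _ g'])
    show "linear_on tensor_scale s' (tensor_square scale) g' \<and>
      (\<forall>a b. g' (pure_tensor scale a b) = h a b) \<and> (\<forall>t. t \<notin> tensor_square scale \<longrightarrow> g' t = 0)"
      by (rule *)
    show "k = g'" if k: "linear_on tensor_scale s' (tensor_square scale) k \<and>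
      (\<forall>a b. k (pure_tensor scale a b) = h a b) \<and> (\<forall>t. t \<notin> tensor_square scale \<longrightarrow> k t = 0)" for k
    proof
      fix t
      show "k t = g' t"
      proof (cases "t \<in> tensor_square scale")
        case True
        then show ?thesis
          using linear_on_span_eq[OF conjunct1[OF k] g(1) _ True] k g(2) by (simp add: g'_def)
      next
        case False
        then show ?thesis using k by (simp add: g'_def)
      qed
    qed
  qed
qed

lemma
  assumes "vector_space s'" and "bilinear_map scale s' h"
  shows linear_on_tensor_lift: "linear_on tensor_scale s' (tensor_square scale) (tensor_lift scale s' h)"
    and tensor_lift_pure: "tensor_lift scale s' h (pure_tensor scale a b) = h a b"
  using theI'[OF tensor_universal[OF assms]] unfolding tensor_lift_def by blast+

lemma bilinear_pure_tensor: "bilinear_map scale tensor_scale (pure_tensor scale)"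
  by (rule bilinear_mapI[OF vector_space_axioms tensor.vector_space_axioms])
    (auto simp: pure_tensor_def fun_eq_iff tensor_scale_def bilinear_mapD)

lemma
  assumes "vector_space s'" and "bilinear_map scale s' h"
  shows tensor_lift_0: "tensor_lift scale s' h 0 = 0"
    and tensor_lift_add_arg: "t \<in> tensor_square scale \<Longrightarrow> u \<in> tensor_square scale \<Longrightarrow>
      tensor_lift scale s' h (t + u) = tensor_lift scale s' h t + tensor_lift scale s' h u"
    and tensor_lift_scale_arg: "t \<in> tensor_square scale \<Longrightarrow>
      tensor_lift scale s' h (tensor_scale c t) = s' c (tensor_lift scale s' h t)"
proof -
  interpret X: vector_space s' by fact
  note l = linear_on_tensor_lift[OF assms]
  show "t \<in> tensor_square scale \<Longrightarrow> u \<in> tensor_square scale \<Longrightarrow>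
      tensor_lift scale s' h (t + u) = tensor_lift scale s' h t + tensor_lift scale s' h u"
    "t \<in> tensor_square scale \<Longrightarrow>
      tensor_lift scale s' h (tensor_scale c t) = s' c (tensor_lift scale s' h t)"
    using l by (auto simp: linear_on_def)
  show "tensor_lift scale s' h 0 = 0" by (rule linear_on_zero[OF l])
qed

end

section \<open>The bracket and the involution of the envelope\<close>

context leibniz_triple_system
begin

declare zero_fun_apply [simp del] plus_fun_apply [simp del] minus_apply [simp del] uminus_apply [simp del]

abbreviation "sq \<equiv> tensor_square scale"
abbreviation "tens \<equiv> pure_tensor scale"
abbreviation "U \<equiv> env_carrier scale"
abbreviation "br \<equiv> env_bracket scale triple"

lemma triple_add [simp]:
  "triple (a + a') b c = triple a b c + triple a' b c"
  "triple a (b + b') c = triple a b c + triple a b' c"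
  "triple a b (c + c') = triple a b c + triple a b c'"
  using linear_1 linear_2 linear_3 unfolding Vector_Spaces.linear_iff by blast+

lemma triple_scale [simp]:
  "triple (scale k a) b c = scale k (triple a b c)"
  "triple a (scale k b) c = scale k (triple a b c)"
  "triple a b (scale k c) = scale k (triple a b c)"
  using linear_1 linear_2 linear_3 unfolding Vector_Spaces.linear_iff by blast+

lemma triple_zero [simp]: "triple 0 b c = 0" "triple a 0 c = 0" "triple a b 0 = 0"
  using triple_scale(1)[of 0 0 b c] triple_scale(2)[of a 0 0 c] triple_scale(3)[of a b 0 0] by simp_all

lemmas tens_add = bilinear_mapD(1,3)[OF bilinear_pure_tensor]
lemmas tens_scale = bilinear_mapD(2,4)[OF bilinear_pure_tensor]

lemma tens_zero: "tens 0 b = 0" "tens a 0 = 0"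
  using tens_scale(1)[of 0 0 b] tens_scale(2)[of a 0 0] by simp_all

lemma tens_diff: "tens (a - a') b = tens a b - tens a' b" "tens a (b - b') = tens a b - tens a b'"
  using tens_add(1)[of "a - a'" a'] tens_add(2)[of _ "b - b'" b'] by (simp_all add: eq_diff_eq)

text \<open>The brackets \<open>[u, b]\<close>, \<open>[a, w]\<close>, \<open>[p \<otimes> q, w]\<close> and \<open>[u, w]\<close>.\<close>

definition "brL b = tensor_lift scale scale (\<lambda>p q. triple p q b)"
definition "brR a = tensor_lift scale scale (\<lambda>p q. triple a p q - triple a q p)"
definition "brQ p q = tensor_lift scale tensor_scale (\<lambda>r s. tens (triple p q r) s - tens (triple p q s) r)"
definition "brT w = tensor_lift scale tensor_scale (\<lambda>p q. brQ p q w)"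

lemma br_eq: "br (a, u) (b, w) = (brL b u + brR a w, tens a b + brT w u)"
  by (simp add: env_bracket_def brL_def brR_def brQ_def brT_def)

lemma bilL: "bilinear_map scale scale (\<lambda>p q. triple p q b)"
  by (rule bilinear_mapI[OF vector_space_axioms vector_space_axioms]) simp_all

lemma bilR: "bilinear_map scale scale (\<lambda>p q. triple a p q - triple a q p)"
  by (rule bilinear_mapI[OF vector_space_axioms vector_space_axioms])
    (simp_all add: scale_right_diff_distrib)

lemma bilQ: "bilinear_map scale tensor_scale (\<lambda>r s. tens (triple p q r) s - tens (triple p q s) r)"
  by (rule bilinear_mapI[OF vector_space_axioms tensor.vector_space_axioms])
    (simp_all add: tens_add tens_scale tensor.scale_right_diff_distrib)

lemmas lift_simps = tensor_lift_0 tensor_lift_pure tensor_lift_add_arg tensor_lift_scale_arg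

lemmas L_simps = lift_simps[OF vector_space_axioms bilL, folded brL_def]
lemmas R_simps = lift_simps[OF vector_space_axioms bilR, folded brR_def]
lemmas Q_simps = lift_simps[OF tensor.vector_space_axioms bilQ, folded brQ_def]

lemma L_par: "u \<in> sq \<Longrightarrow> brL (b + b') u = brL b u + brL b' u \<and> brL (scale c b) u = scale c (brL b u)"
  by (induction u rule: tensor_square_induct)
    (simp_all add: L_simps tensor_square_closed scale_right_distrib algebra_simps)

lemma R_par: "u \<in> sq \<Longrightarrow> brR (b + b') u = brR b u + brR b' u \<and> brR (scale c b) u = scale c (brR b u)"
  by (induction u rule: tensor_square_induct)
    (simp_all add: R_simps tensor_square_closed scale_right_distrib scale_right_diff_distrib algebra_simps)

lemma Q_par: "w \<in> sq \<Longrightarrow>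
    brQ (p + p') q w = brQ p q w + brQ p' q w \<and> brQ (scale c p) q w = tensor_scale c (brQ p q w) \<and>
    brQ p (q + q') w = brQ p q w + brQ p q' w \<and> brQ p (scale c q) w = tensor_scale c (brQ p q w)"
  by (induction w rule: tensor_square_induct)
    (simp_all add: Q_simps tensor_square_closed tens_add tens_scale tensor.scale_right_distrib
      tensor.scale_right_diff_distrib algebra_simps)

lemma bilT: "w \<in> sq \<Longrightarrow> bilinear_map scale tensor_scale (\<lambda>p q. brQ p q w)"
  by (rule bilinear_mapI[OF vector_space_axioms tensor.vector_space_axioms]) (simp_all add: Q_par)

lemmas T_simps = lift_simps[OF tensor.vector_space_axioms bilT, folded brT_def]

lemma T_par: "u \<in> sq \<Longrightarrow> w \<in> sq \<Longrightarrow> w' \<in> sq \<Longrightarrow>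
    brT (w + w') u = brT w u + brT w' u \<and> brT (tensor_scale c w) u = tensor_scale c (brT w u)"
  by (induction u rule: tensor_square_induct)
    (simp_all add: T_simps Q_simps tensor_square_closed tensor.scale_right_distrib algebra_simps)

lemma Q_closed: "w \<in> sq \<Longrightarrow> brQ p q w \<in> sq"
  by (induction w rule: tensor_square_induct) (simp_all add: Q_simps tensor_square_closed)

lemma T_closed: "u \<in> sq \<Longrightarrow> w \<in> sq \<Longrightarrow> brT w u \<in> sq"
  by (induction u rule: tensor_square_induct) (simp_all add: T_simps tensor_square_closed Q_closed)

lemma par_0: "u \<in> sq \<Longrightarrow> brL 0 u = 0" "u \<in> sq \<Longrightarrow> brR 0 u = 0" "u \<in> sq \<Longrightarrow> brT 0 u = 0"
  using L_par[of u 0 0 0] R_par[of u 0 0 0] T_par[of u 0 0 0] tensor_square_closed(1)[of scale]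
  by auto

lemmas br_simps = br_eq L_simps R_simps Q_simps T_simps par_0 tensor_square_closed tens_zero

theorem env_bracket_pure:
  "br (env_incl a) (env_incl b) = (0, tens a b)"
  "br (0, tens a b) (env_incl c) = env_incl (triple a b c)"
  "br (env_incl a) (0, tens b c) = env_incl (triple a b c - triple a c b)"
  "br (0, tens a b) (0, tens c d) = (0, tens (triple a b c) d - tens (triple a b d) c)"
  by (simp_all add: br_simps env_incl_def)

lemma env_carrier_closed:
  "0 \<in> U" "x \<in> U \<Longrightarrow> y \<in> U \<Longrightarrow> x + y \<in> U" "x \<in> U \<Longrightarrow> env_scale scale c x \<in> U"
  "x \<in> U \<Longrightarrow> y \<in> U \<Longrightarrow> br x y \<in> U"
  by (auto simp: env_carrier_def env_scale_def br_eq tensor_square_closed T_closed zero_prod_def)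

lemma env_carrier_basic [simp]: "env_incl a \<in> U" "(a, 0) \<in> U" "(0, tens a b) \<in> U"
  by (simp_all add: env_carrier_def env_incl_def tensor_square_closed)

theorem env_bracket_bilinear:
  assumes "x \<in> U" "x' \<in> U" "y \<in> U"
  shows "br (x + x') y = br x y + br x' y" "br (env_scale scale c x) y = env_scale scale c (br x y)"
    "br y (x + x') = br y x + br y x'" "br y (env_scale scale c x) = env_scale scale c (br y x)"
  using assms
  by (auto simp: env_carrier_def env_scale_def br_simps L_par R_par T_par tens_add tens_scale
      scale_right_distrib tensor.scale_right_distrib algebra_simps)

lemma env_bracket_theta:
  assumes "x \<in> U" "y \<in> U"
  shows "br (env_theta x) (env_theta y) = env_theta (br x y)"
proof -
  obtain a u b w where xy: "x = (a, u)" "y = (b, w)" "u \<in> sq" "w \<in> sq"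
    using assms by (auto simp: env_carrier_def)
  have L: "brL (- b) u = - brL b u"
    by (rule minus_unique[symmetric]) (use L_par[of u b "- b"] xy par_0 in simp)
  have R: "brR (- a) w = - brR a w"
    by (rule minus_unique[symmetric]) (use R_par[of w a "- a"] xy par_0 in simp)
  have "tens (- a) (- b) = tens a b"
    using tens_diff(1)[of 0 a "- b"] tens_diff(2)[of a 0 b] by (simp add: tens_zero)
  with L R show ?thesis by (simp add: xy env_theta_def br_eq)
qed

theorem env_theta_involution:
  fixes x :: "('k, 'v) envelope"
  shows "env_automorphism scale triple env_theta" "env_theta (env_theta x) = x"
  "{x \<in> U. env_theta x = - x} = range env_incl"
proof -
  have *: "env_theta (env_theta x) = x" for x :: "('k, 'v) envelope"
    by (cases x) (simp add: env_theta_def)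
  then show "env_theta (env_theta x) = x" .
  have closed: "env_theta x \<in> U" if "x \<in> U" for x
    using that by (auto simp: env_theta_def env_carrier_def)
  have "bij_betw env_theta U U"
    by (rule bij_betw_byWitness[where f' = env_theta]) (auto simp: * closed)
  moreover have "linear_on (env_scale scale) (env_scale scale) U env_theta"
    by (auto simp: linear_on_def env_theta_def env_scale_def)
  ultimately show "env_automorphism scale triple env_theta"
    by (simp add: env_automorphism_def env_bracket_theta)
  have half: "u = 0" if "u = - u" for u :: "('k, 'v) tensor"
  proof
    fix \<beta>
    have "u \<beta> = - u \<beta>" using fun_cong[OF that, of \<beta>] by (simp add: uminus_apply)
    then show "u \<beta> = 0 \<beta>" using eq_neg_iff_add_eq_0[of "u \<beta>" "u \<beta>"] by (simp add: zero_fun_apply)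
  qed
  show "{x \<in> U. env_theta x = - x} = range env_incl"
    using half by (auto simp: env_theta_def env_incl_def env_carrier_def tensor_square_closed)
qed

theorem env_theta_unique:
  assumes "env_automorphism scale triple \<phi>"
    and T: "{x \<in> U. \<phi> x = - x} = range env_incl"
    and x: "x \<in> U"
  shows "\<phi> x = env_theta x"
proof -
  have lin: "linear_on (env_scale scale) (env_scale scale) U \<phi>"
    and hom: "\<And>x y. x \<in> U \<Longrightarrow> y \<in> U \<Longrightarrow> \<phi> (br x y) = br (\<phi> x) (\<phi> y)"
    using assms(1) by (auto simp: env_automorphism_def)
  have neg: "\<phi> (env_incl a) = env_theta (env_incl a)" for a
  proof -
    have "env_incl a \<in> {x \<in> U. \<phi> x = - x}" unfolding T by blast
    then show ?thesis by (simp add: env_theta_def env_incl_def)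
  qed
  have tens: "\<phi> (0, tens a b) = (0, tens a b)" for a b
  proof -
    have "\<phi> (br (env_incl a) (env_incl b)) = env_theta (br (env_incl a) (env_incl b))"
      by (simp only: hom env_carrier_basic neg env_bracket_theta)
    then show ?thesis by (simp add: env_bracket_pure) (simp add: env_theta_def)
  qed
  have in_U: "(0, t) \<in> U" if "t \<in> sq" for t
    using that by (simp add: env_carrier_def)
  have "linear_on tensor_scale (env_scale scale) sq (\<lambda>t. (0, t))"
    by (auto simp: linear_on_def env_scale_def)
  moreover have "linear_on tensor_scale (env_scale scale) sq (\<lambda>t. \<phi> (0, t))"
    unfolding linear_on_def
  proof (intro conjI ballI allI)
    fix t t' c assume t: "t \<in> sq" "t' \<in> sq"
    have "\<phi> ((0, t) + (0, t')) = \<phi> (0, t) + \<phi> (0, t')"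
      using lin in_U t unfolding linear_on_def by blast
    then show "\<phi> (0, t + t') = \<phi> (0, t) + \<phi> (0, t')" by simp
  next
    fix c t assume t: "t \<in> sq"
    have "\<phi> (env_scale scale c (0, t)) = env_scale scale c (\<phi> (0, t))"
      using lin in_U t unfolding linear_on_def by blast
    then show "\<phi> (0, tensor_scale c t) = env_scale scale c (\<phi> (0, t))" by (simp add: env_scale_def)
  qed
  ultimately have fix_sq: "\<phi> (0, t) = (0, t)" if "t \<in> sq" for t
    using linear_on_span_eq[OF _ _ _ that, of "env_scale scale" "\<lambda>t. \<phi> (0, t)" "\<lambda>t. (0, t)"] tens
    by blast
  obtain a u where xu: "x = env_incl a + (0, u)" and u: "u \<in> sq"
    using x by (cases x) (auto simp: env_carrier_def env_incl_def)
  have "\<phi> x = \<phi> (env_incl a) + \<phi> (0, u)"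
    using lin in_U[OF u] env_carrier_basic(1) unfolding xu linear_on_def by blast
  then show ?thesis by (simp add: neg fix_sq u xu) (simp add: env_theta_def env_incl_def)
qed

end

end

theory Submission
  imports Defs
begin

text \<open>\<open>T\<close> is the \<open>-1\<close>-eigenspace of \<open>\<theta>\<close>, so a bijection commuting with \<open>\<theta>\<close> and with negation maps
  \<open>T\<close> onto itself. The triple product is the iterated bracket \<open>{abc} = [[a, b], c]\<close> of the envelope,
  hence is preserved.\<close>

context leibniz_triple_system
begin

lemma env_bracket_triple: "br (br (env_incl a) (env_incl b)) (env_incl c) = env_incl (triple a b c)"
  by (simp add: env_bracket_pure)

lemma env_automorphism_minus:
  assumes "env_automorphism scale triple f" "x \<in> U"
  shows "f (- x) = - f x"
proof -
  have *: "env_scale scale (- 1) y = - y" for y :: "('k, 'v) envelope"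
    by (simp add: env_scale_def prod_eq_iff)
  have "f (env_scale scale (- 1) x) = env_scale scale (- 1) (f x)"
    using assms by (simp add: env_automorphism_def linear_on_def)
  then show ?thesis by (simp only: *)
qed

text \<open>Equality is needed, not just an inclusion: the reverse inclusion later yields
  surjectivity of the restriction.\<close>

lemma env_automorphism_image_incl:
  assumes f: "env_automorphism scale triple f"
    and comm: "\<forall>x\<in>U. f (env_theta x) = env_theta (f x)"
  shows "f ` range env_incl = range env_incl"
proof -
  have bij: "bij_betw f U U" using f by (simp add: env_automorphism_def)
  \<comment> \<open>Injectivity of \<open>f\<close> is known on \<open>U\<close> only, so both sides
    compared below must lie there; the tensor part of \<open>- x\<close> is the difference
    \<open>0 - snd x\<close>.\<close>
  have closed: "env_theta x \<in> U" "- x \<in> U" if "x \<in> U" for x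
    using that tensor_square_closed(3)[OF tensor_square_closed(1), of "snd x" scale]
    by (simp_all add: env_theta_def env_carrier_def mem_Times_iff case_prod_unfold)
  have eigen: "env_theta (f x) = - f x \<longleftrightarrow> env_theta x = - x" if x: "x \<in> U" for x
  proof -
    have "env_theta (f x) = - f x \<longleftrightarrow> f (env_theta x) = f (- x)"
      using comm x by (simp add: env_automorphism_minus[OF f])
    also have "\<dots> \<longleftrightarrow> env_theta x = - x"
      using closed[OF x] by (simp add: inj_on_eq_iff[OF bij_betw_imp_inj_on[OF bij]])
    finally show ?thesis .
  qed
  have "f ` {x \<in> U. env_theta x = - x} = f ` {x \<in> U. env_theta (f x) = - f x}"
    by (simp add: eigen cong: conj_cong)
  also have "\<dots> = {y \<in> f ` U. env_theta y = - y}"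
    by blast
  also have "f ` U = U"
    by (rule bij_betw_imp_surj_on[OF bij])
  finally have "f ` {x \<in> U. env_theta x = - x} = {x \<in> U. env_theta x = - x}" .
  \<comment> \<open>Identifying the eigenspace with \<open>range env_incl\<close> is where
    characteristic 0 enters: \<open>u = - u\<close> has to force \<open>u = 0\<close>.\<close>
  then show ?thesis by (simp only: env_theta_involution(3))
qed

text \<open>The hypothesis \<open>image\<close> keeps \<open>f\<close> inside the range of
  \<open>env_incl\<close>, where \<open>inv env_incl\<close> is a genuine inverse.\<close>

lemma triple_automorphism_restrict:
  assumes f: "env_automorphism scale triple f"
    and image: "f ` range env_incl = range env_incl"
  shows "triple_automorphism scale triple (inv env_incl \<circ> f \<circ> env_incl)"
proof -
  let ?i = "env_incl :: 'v \<Rightarrow> ('k, 'v) envelope"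
  define g where "g = inv ?i \<circ> f \<circ> ?i"
  have inj: "inj ?i" by (simp add: inj_def env_incl_def)
  \<comment> \<open>With \<open>eqI\<close>, this intertwining relation reduces each equation about
    \<open>g\<close> to one about \<open>f\<close> on the envelope.\<close>
  have incl: "?i (g a) = f (?i a)" for a
    unfolding g_def comp_def by (rule f_inv_into_f) (rule subsetD[OF equalityD1[OF image]], intro imageI rangeI)
  have eqI: "a = b" if "?i a = ?i b" for a b
    using that inj by (simp add: inj_eq)
  have add: "?i (a + b) = ?i a + ?i b" and scale: "?i (scale c a) = env_scale scale c (?i a)" for a b c
    by (simp_all add: env_incl_def env_scale_def)
  have "g (a + b) = g a + g b" for a b
    using f by (intro eqI) (simp add: incl add env_automorphism_def linear_on_def)
  moreover have "g (scale c a) = scale c (g a)" for a c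
    using f by (intro eqI) (simp add: incl scale env_automorphism_def linear_on_def)
  ultimately have "Vector_Spaces.linear scale scale g"
    by (simp add: Vector_Spaces.linear_iff vector_space_axioms)
  moreover have "bij g"
  proof (rule bijI)
    have "inj_on f U" using f by (simp add: env_automorphism_def bij_betw_def)
    show "inj g"
    proof (rule injI)
      fix a b assume "g a = g b"
      then have "f (?i a) = f (?i b)" by (simp flip: incl)
      then show "a = b" by (intro eqI) (simp add: inj_on_eq_iff[OF \<open>inj_on f U\<close>])
    qed
    show "surj g"
      unfolding surj_def
    proof
      fix b
      \<comment> \<open>Here the inclusion of \<open>range ?i\<close> in its image under
        \<open>f\<close> is used.\<close>
      have "?i b \<in> f ` range ?i" by (simp only: image rangeI)
      then obtain a where "?i b = ?i (g a)" by (metis imageE incl)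
      then show "\<exists>a. b = g a" by (intro exI eqI)
    qed
  qed
  moreover have "g (triple a b c) = triple (g a) (g b) (g c)" for a b c
  proof (rule eqI)
    have hom: "f (br x y) = br (f x) (f y)" if "x \<in> U" "y \<in> U" for x y
      using f that by (simp add: env_automorphism_def)
    show "?i (g (triple a b c)) = ?i (triple (g a) (g b) (g c))"
      \<comment> \<open>Both triple products unfold to iterated brackets; \<open>hom\<close> then
        applies twice, the inner bracket being in \<open>U\<close> by closure.\<close>
      by (simp only: incl hom env_carrier_closed env_carrier_basic flip: env_bracket_triple)
  qed
  ultimately show ?thesis
    unfolding triple_automorphism_def g_def by blast
qed

end

theorem proposition3p3:
  fixes scale :: "'k::field_char_0 \<Rightarrow> 'v::ab_group_add \<Rightarrow> 'v"
    and Basis :: "'v set"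
    and triple :: "'v \<Rightarrow> 'v \<Rightarrow> 'v \<Rightarrow> 'v"
    and f :: "('k, 'v) envelope \<Rightarrow> ('k, 'v) envelope"
  assumes "leibniz_triple_system scale Basis triple"
    and "env_automorphism scale triple f"
    and "\<forall>x\<in>env_carrier scale. f (env_theta x) = env_theta (f x)"
  shows "f ` range env_incl \<subseteq> range env_incl
    \<and> triple_automorphism scale triple (inv env_incl \<circ> f \<circ> env_incl)"
proof -
  interpret leibniz_triple_system scale Basis triple by fact
  have "f ` range env_incl = range env_incl"
    by (rule env_automorphism_image_incl) (use assms in auto)
  with assms(2) show ?thesis
    by (simp add: triple_automorphism_restrict)
qed

end
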